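(* Let $r,s$ be real numbers with $s<r$ and $s\le 0$, let $G$ be a finite group and let $n$ be a positive divisor of $|G|$. Then $T_{G,n}(r,s)\ge 0$, with equality if and only if for every positive divisor $m$ of $n$, $G$ contains exactly one cyclic subgroup of order $m$.
   Context: $o(x)$ is the order of $x$, $\varphi$ is Euler's totient function, and $C_N$ is the cyclic group of order $N$. For a finite group $G$, a positive divisor $n$ of $|G|$ and reals $r,s$, define $R_{G,n}(r,s) := \sum_{x\in G,\ o(x)\mid n} \frac{o(x)^s}{\varphi(o(x))^r}$ and $T_{G,n}(r,s) := R_{G,n}(r,s) - R_{C_{|G|},n}(r,s)$. *)

theory Defs
  imports "HOL-Algebra.Algebra" "HOL-Number_Theory.Number_Theory"
begin

definition R_sum :: "('a, 'b) monoid_scheme \<Rightarrow> nat \<Rightarrow> real \<Rightarrow> real \<Rightarrow> real" where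
  "R_sum G n r s =
     (\<Sum>x\<in>{x \<in> carrier G. group.ord G x dvd n}.
        real (group.ord G x) powr s / real (totient (group.ord G x)) powr r)"

definition T_diff :: "('a, 'b) monoid_scheme \<Rightarrow> nat \<Rightarrow> real \<Rightarrow> real \<Rightarrow> real" where
  "T_diff G n r s = R_sum G n r s - R_sum (integer_mod_group (order G)) n r s"

end

theory Submission
  imports Defs
begin

text \<open>
  The function \<open>f(d) = d\<^sup>s / \<phi>(d)\<^sup>r\<close> is multiplicative, so Moebius inversion on the divisors of \<open>n\<close>
  gives \<open>f(d) = (\<Sum>d | m | n. a(m))\<close>, where \<open>a(m)\<close> is a product of factors \<open>f(p\<^sup>k) - f(p\<^sup>k\<^sup>+\<^sup>1)\<close> and
  \<open>f(p\<^sup>k)\<close>; hence \<open>a(m) \<ge> 0\<close>. With \<open>N(m)\<close> the number of solutions of \<open>x\<^sup>m = 1\<close> in \<open>G\<close> this turns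
  \<open>T\<close> into \<open>\<Sum>m | n. a(m) (N(m) - m)\<close>, which is nonnegative by Frobenius' theorem that \<open>m\<close> divides
  \<open>N(m)\<close> for \<open>m\<close> dividing \<open>|G|\<close>. The weight \<open>a(m)\<close> vanishes only if \<open>s = 0\<close>, \<open>n\<close> is even and \<open>m\<close> is odd,
  because then \<open>f(1) = f(2)\<close>. In that case \<open>N(2) = 2\<close> makes the involution unique, hence central,
  and \<open>N(2m) = 2 N(m)\<close> recovers \<open>N(m) = m\<close>.

  For Frobenius' theorem, \<open>N(ab) = (\<Sum>z\<^sup>b = 1. number of solutions of y\<^sup>a = 1 in the centralizer of z)\<close>
  for coprime \<open>a\<close>, \<open>b\<close>. Grouping the \<open>z\<close> by conjugacy classes reduces it to prime powers \<open>a = q\<^sup>k\<close>. If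
  \<open>q\<^sup>k\<close> is the full \<open>q\<close>-part of \<open>|G|\<close>, the same formula applied to \<open>ab = |G|\<close> gives an induction on
  \<open>|G|\<close>; the remaining \<open>q\<^sup>k\<close> follow since \<open>\<phi>(d)\<close> divides the number of elements of order \<open>d\<close>.
\<close>

section \<open>Solutions of \<open>x\<^sup>n = 1\<close> and Frobenius' theorem\<close>

definition roots :: "('a, 'b) monoid_scheme \<Rightarrow> nat \<Rightarrow> 'a set" where
  "roots G n = {x \<in> carrier G. x [^]\<^bsub>G\<^esub> n = \<one>\<^bsub>G\<^esub>}"

definition centralizer :: "('a, 'b) monoid_scheme \<Rightarrow> 'a \<Rightarrow> 'a set" where
  "centralizer G x = {g \<in> carrier G. g \<otimes>\<^bsub>G\<^esub> x = x \<otimes>\<^bsub>G\<^esub> g}"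

section \<open>Centralizers, conjugation and sums over conjugacy classes\<close>

context group
begin

lemma inv_cancel_left: "g \<in> carrier G \<Longrightarrow> y \<in> carrier G \<Longrightarrow> inv g \<otimes> (g \<otimes> y) = y"
  by (simp add: m_assoc[symmetric])

lemma subgroup_centralizer:
  assumes x: "x \<in> carrier G"
  shows "subgroup (centralizer G x) G"
proof (rule subgroupI)
  fix a assume "a \<in> centralizer G x"
  then have a: "a \<in> carrier G" "a \<otimes> x = x \<otimes> a"
    by (auto simp: centralizer_def)
  have "inv a \<otimes> x = inv a \<otimes> (x \<otimes> a) \<otimes> inv a"
    using a x by (simp add: m_assoc)
  also have "\<dots> = inv a \<otimes> (a \<otimes> x) \<otimes> inv a"
    using a by simp
  also have "\<dots> = x \<otimes> inv a"
    using a(1) x by (simp add: m_assoc inv_cancel_left)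
  finally show "inv a \<in> centralizer G x"
    using a by (simp add: centralizer_def)
next
  fix a b assume "a \<in> centralizer G x" "b \<in> centralizer G x"
  then show "a \<otimes> b \<in> centralizer G x"
    using x unfolding centralizer_def by (auto simp: m_assoc) (metis m_assoc)
qed (use x in \<open>auto simp: centralizer_def\<close>)

lemma group_centralizer:
  "x \<in> carrier G \<Longrightarrow> group (G\<lparr>carrier := centralizer G x\<rparr>)"
  using subgroup_centralizer subgroup_imp_group by blast

lemma roots_subgroup:
  "roots (G\<lparr>carrier := H\<rparr>) n = {x \<in> H. x [^] n = \<one>}"
  by (simp add: roots_def flip: nat_pow_consistent)

lemma roots_eq_ord: "roots G n = {x \<in> carrier G. local.ord x dvd n}"
  using pow_eq_id by (auto simp: roots_def)

lemma nat_pow_conj: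
  assumes "g \<in> carrier G" "x \<in> carrier G"
  shows "(g \<otimes> x \<otimes> inv g) [^] (n::nat) = g \<otimes> x [^] n \<otimes> inv g"
proof (induction n)
  case (Suc n)
  have "g \<otimes> x [^] n \<otimes> inv g \<otimes> (g \<otimes> x \<otimes> inv g) = g \<otimes> x [^] n \<otimes> (inv g \<otimes> g) \<otimes> x \<otimes> inv g"
    using assms by (simp add: m_assoc inv_cancel_left)
  also have "\<dots> = g \<otimes> x [^] Suc n \<otimes> inv g"
    using assms by (simp add: m_assoc)
  finally show ?case using Suc by simp
qed (use assms in simp)

lemma conj_eq_iff:
  assumes "g \<in> carrier G" "x \<in> carrier G" "y \<in> carrier G"
  shows "g \<otimes> x \<otimes> inv g = g \<otimes> y \<otimes> inv g \<longleftrightarrow> x = y"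
  using assms by (metis conjugation_is_inj)

lemma conj_eq_one_iff:
  assumes "g \<in> carrier G" "x \<in> carrier G"
  shows "g \<otimes> x \<otimes> inv g = \<one> \<longleftrightarrow> x = \<one>"
  using conj_eq_iff[OF assms one_closed] assms by simp

lemma conj_in_roots_iff:
  assumes "g \<in> carrier G" "x \<in> carrier G"
  shows "g \<otimes> x \<otimes> inv g \<in> roots G n \<longleftrightarrow> x \<in> roots G n"
  using assms by (simp add: roots_def nat_pow_conj conj_eq_one_iff)

lemma conj_mult:
  assumes "g \<in> carrier G" "x \<in> carrier G" "y \<in> carrier G"
  shows "(g \<otimes> x \<otimes> inv g) \<otimes> (g \<otimes> y \<otimes> inv g) = g \<otimes> (x \<otimes> y) \<otimes> inv g"
proof -
  have "(g \<otimes> x \<otimes> inv g) \<otimes> (g \<otimes> y \<otimes> inv g) = g \<otimes> x \<otimes> (inv g \<otimes> g) \<otimes> y \<otimes> inv g"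
    using assms by (simp add: m_assoc inv_cancel_left)
  then show ?thesis using assms by (simp add: m_assoc)
qed

lemma conj_in_centralizer_iff:
  assumes "g \<in> carrier G" "x \<in> carrier G" "y \<in> carrier G"
  shows "g \<otimes> y \<otimes> inv g \<in> centralizer G (g \<otimes> x \<otimes> inv g) \<longleftrightarrow> y \<in> centralizer G x"
  using assms by (simp add: centralizer_def conj_mult conj_eq_iff)

lemma bij_betw_conj:
  assumes g: "g \<in> carrier G"
  shows "bij_betw (\<lambda>x. g \<otimes> x \<otimes> inv g) (carrier G) (carrier G)"
proof (rule bij_betw_byWitness[where f' = "\<lambda>x. inv g \<otimes> x \<otimes> g"])
  show "\<forall>a\<in>carrier G. inv g \<otimes> (g \<otimes> a \<otimes> inv g) \<otimes> g = a"
    using g by (simp add: m_assoc) (simp add: m_assoc[symmetric])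
  show "\<forall>a\<in>carrier G. g \<otimes> (inv g \<otimes> a \<otimes> g) \<otimes> inv g = a"
    using g by (simp add: m_assoc) (simp add: m_assoc[symmetric])
qed (use g in auto)

text \<open>Conjugation by \<open>g\<close> carries the centralizer of \<open>x\<close> onto that of
  the conjugate and commutes with powers. The count is therefore a class function of
  \<open>x\<close>, as \<open>dvd_sum_class_function\<close> requires.\<close>

lemma card_centralizer_roots_conj:
  assumes g: "g \<in> carrier G" and x: "x \<in> carrier G"
  shows "card (roots (G\<lparr>carrier := centralizer G (g \<otimes> x \<otimes> inv g)\<rparr>) n) =
         card (roots (G\<lparr>carrier := centralizer G x\<rparr>) n)"
proof -
  have "bij_betw (\<lambda>y. g \<otimes> y \<otimes> inv g) {y \<in> centralizer G x. y [^] n = \<one>}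
      {y \<in> centralizer G (g \<otimes> x \<otimes> inv g). y [^] n = \<one>}"
    unfolding bij_betw_def
  proof
    show "inj_on (\<lambda>y. g \<otimes> y \<otimes> inv g) {y \<in> centralizer G x. y [^] n = \<one>}"
      by (rule inj_on_subset[OF bij_betw_imp_inj_on[OF bij_betw_conj[OF g]]])
         (auto simp: centralizer_def)
    show "(\<lambda>y. g \<otimes> y \<otimes> inv g) ` {y \<in> centralizer G x. y [^] n = \<one>} =
        {y \<in> centralizer G (g \<otimes> x \<otimes> inv g). y [^] n = \<one>}" (is "?L = ?R")
    proof
      show "?L \<subseteq> ?R"
        using g x conj_in_centralizer_iff[OF g x]
        by (auto simp: nat_pow_conj conj_eq_one_iff centralizer_def)
    next
      show "?R \<subseteq> ?L"
      proof
        fix z assume z: "z \<in> ?R"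
        then have "z \<in> carrier G" by (simp add: centralizer_def)
        then obtain y where y: "y \<in> carrier G" "z = g \<otimes> y \<otimes> inv g"
          using bij_betw_conj[OF g] by (auto simp: bij_betw_def)
        then have "y \<in> centralizer G x" "y [^] n = \<one>"
          using z g x by (auto simp: conj_in_centralizer_iff nat_pow_conj conj_eq_one_iff)
        then show "z \<in> ?L" using y by blast
      qed
    qed
  qed
  then show ?thesis
    by (simp add: roots_subgroup bij_betw_same_card)
qed

text \<open>A conjugacy class contributes its size times \<open>f x\<close>, and its size times the
  centralizer order is \<open>order G\<close>. As \<open>d\<close> divides both the size times
  \<open>d\<close> and \<open>order G\<close>, it divides the size times the gcd.\<close>

lemma dvd_sum_class_function:
  fixes f :: "'a \<Rightarrow> nat"
  assumes fin: "finite (carrier G)" and d: "d dvd order G"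
    and inv: "\<And>g x. g \<in> carrier G \<Longrightarrow> x \<in> carrier G \<Longrightarrow> f (g \<otimes> x \<otimes> inv g) = f x"
    and dvd: "\<And>x. x \<in> carrier G \<Longrightarrow> gcd d (card (centralizer G x)) dvd f x"
  shows "d dvd (\<Sum>x\<in>carrier G. f x)"
proof -
  let ?\<phi> = "\<lambda>g. (\<lambda>h \<in> carrier G. g \<otimes> h \<otimes> (inv g))"
  interpret conj: group_action G "carrier G" ?\<phi>
    by (rule action_by_conjugation)
  have "d dvd (\<Sum>x\<in>orb. f x)" if orb: "orb \<in> orbits G (carrier G) ?\<phi>" for orb
  proof -
    obtain x where x: "x \<in> carrier G" "orb = orbit G ?\<phi> x"
      using orb by (auto simp: orbits_def)
    have "g \<otimes> x \<otimes> inv g = x \<longleftrightarrow> g \<otimes> x = x \<otimes> g" if "g \<in> carrier G" for g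
      using that x inv_solve_right[of x "g \<otimes> x" g] by auto
    then have "stabilizer G ?\<phi> x = centralizer G x"
      using x by (auto simp: stabilizer_def centralizer_def)
    then have card: "card orb * card (centralizer G x) = order G"
      using conj.orbit_stabilizer_theorem[OF x(1)] x by simp
    have "(\<Sum>y\<in>orb. f y) = (\<Sum>y\<in>orb. f x)"
      using x inv by (intro sum.cong) (auto simp: orbit_def)
    then have "(\<Sum>y\<in>orb. f y) = card orb * f x" by simp
    moreover have "d dvd card orb * gcd d (card (centralizer G x))"
      using d by (simp add: gcd_mult_distrib_nat card)
    ultimately show ?thesis
      using dvd[OF x(1)] by (metis dvd_refl dvd_trans mult_dvd_mono)
  qed
  then have "d dvd (\<Sum>orb\<in>orbits G (carrier G) ?\<phi>. \<Sum>x\<in>orb. f x)"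
    by (rule dvd_sum)
  then show ?thesis
    by (simp only: conj.disjoint_sum[OF fin])
qed

text \<open>Each \<open>x\<close> with \<open>x\<^sup>a\<^sup>b = 1\<close> splits uniquely as a product of commuting roots of
  exponents \<open>b\<close> and \<open>a\<close>, both powers of \<open>x\<close>.\<close>
lemma card_roots_coprime_mult:
  assumes fin: "finite (carrier G)" and "coprime a b"
  shows "card (roots G (a * b)) = (\<Sum>z\<in>roots G b. card (roots (G\<lparr>carrier := centralizer G z\<rparr>) a))"
proof -
  \<comment> \<open>Chinese remainder exponents: raising to \<open>e\<close> extracts the factor
    killed by \<open>a\<close>, raising to \<open>e'\<close> the factor killed by
    \<open>b\<close>.\<close>
  obtain e where e: "[e = 1] (mod a)" "[e = 0] (mod b)"
    using binary_chinese_remainder_nat[OF assms(2)] by blast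
  obtain e' where e': "[e' = 0] (mod a)" "[e' = 1] (mod b)"
    using binary_chinese_remainder_nat[OF assms(2)] by blast
  have ee: "[e + e' = 1] (mod a * b)"
    using cong_add[OF e(1) e'(1)] cong_add[OF e(2) e'(2)] assms(2)
    by (intro coprime_cong_mult_nat) auto
  have pow_cong: "x [^] k = x [^] l" if "x \<in> carrier G" "x [^] m = \<one>" "[k = l] (mod m)"
    for x and k l m :: nat
  proof -
    have "local.ord x dvd m" using that pow_eq_id by simp
    then have "[k = l] (mod local.ord x)"
      using that(3) cong_dvd_modulus_nat by blast
    then have "[int k = int l] (mod int (local.ord x))"
      by (simp add: cong_int_iff)
    then have "x [^] int k = x [^] int l"
      using that(1) by (simp add: int_pow_eq mod_eq_dvd_iff cong_def dvd_diff_commute)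
    then show ?thesis by (simp add: int_pow_int)
  qed
  let ?S = "SIGMA z:roots G b. roots (G\<lparr>carrier := centralizer G z\<rparr>) a"
  have "bij_betw (\<lambda>(z, y). z \<otimes> y) ?S (roots G (a * b))"
  proof (rule bij_betw_byWitness[where f' = "\<lambda>x. (x [^] e', x [^] e)"])
    show "\<forall>p\<in>?S. (\<lambda>x. (x [^] e', x [^] e)) (case p of (z, y) \<Rightarrow> z \<otimes> y) = p"
    proof clarsimp
      fix z y assume "z \<in> roots G b" "y \<in> roots (G\<lparr>carrier := centralizer G z\<rparr>) a"
      then have zy: "z \<in> carrier G" "z [^] b = \<one>" "y \<in> carrier G" "y \<otimes> z = z \<otimes> y" "y [^] a = \<one>"
        by (auto simp: roots_def centralizer_def simp flip: nat_pow_consistent)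
      have "(z \<otimes> y) [^] k = z [^] k \<otimes> y [^] k" for k :: nat
        using zy pow_mult_distrib by metis
      moreover have "z [^] e' = z" "y [^] e' = \<one>" "z [^] e = \<one>" "y [^] e = y"
        using pow_cong[OF zy(1,2) e'(2)] pow_cong[OF zy(1,2) e(2)]
          pow_cong[OF zy(3,5) e'(1)] pow_cong[OF zy(3,5) e(1)] zy by auto
      ultimately show "(z \<otimes> y) [^] e' = z \<and> (z \<otimes> y) [^] e = y"
        using zy by simp
    qed
    show "\<forall>x\<in>roots G (a * b). (case (x [^] e', x [^] e) of (z, y) \<Rightarrow> z \<otimes> y) = x"
    proof
      fix x assume "x \<in> roots G (a * b)"
      then have x: "x \<in> carrier G" "x [^] (a * b) = \<one>" by (auto simp: roots_def)
      have "x [^] e' \<otimes> x [^] e = x [^] (e + e')"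
        using x by (simp add: nat_pow_mult add.commute)
      then show "(case (x [^] e', x [^] e) of (z, y) \<Rightarrow> z \<otimes> y) = x"
        using pow_cong[OF x ee] x by simp
    qed
    show "(\<lambda>(z, y). z \<otimes> y) ` ?S \<subseteq> roots G (a * b)"
    proof clarsimp
      fix z y assume "z \<in> roots G b" "y \<in> roots (G\<lparr>carrier := centralizer G z\<rparr>) a"
      then have zy: "z \<in> carrier G" "z [^] b = \<one>" "y \<in> carrier G" "y \<otimes> z = z \<otimes> y" "y [^] a = \<one>"
        by (auto simp: roots_def centralizer_def simp flip: nat_pow_consistent)
      have "(z \<otimes> y) [^] (a * b) = z [^] (b * a) \<otimes> y [^] (a * b)"
        using zy pow_mult_distrib[of z y "a * b"] by (simp add: mult.commute)
      also have "\<dots> = \<one>"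
        using zy by (simp flip: nat_pow_pow)
      finally show "z \<otimes> y \<in> roots G (a * b)" using zy by (simp add: roots_def)
    qed
    show "(\<lambda>x. (x [^] e', x [^] e)) ` roots G (a * b) \<subseteq> ?S"
    proof clarsimp
      fix x assume "x \<in> roots G (a * b)"
      then have x: "x \<in> carrier G" "local.ord x dvd a * b" by (auto simp: roots_eq_ord)
      \<comment> \<open>The order of \<open>x\<close> divides \<open>a * b\<close>. Since
        \<open>e'\<close> already contains \<open>a\<close>, the exponent \<open>b\<close> kills
        \<open>x [^] e'\<close>; symmetrically for \<open>e\<close> and \<open>a\<close>.\<close>
      have "a dvd e'" "b dvd e" using e e' by (auto simp: cong_0_iff)
      then have "local.ord x dvd e' * b" "local.ord x dvd e * a"
        using x(2) by (metis dvd_trans dvd_refl mult_dvd_mono mult.commute)+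
      then show "x [^] e' \<in> roots G b \<and> x [^] e \<in> roots (G\<lparr>carrier := centralizer G (x [^] e')\<rparr>) a"
        using x by (auto simp: roots_def centralizer_def nat_pow_pow pow_eq_id
            nat_pow_mult add.commute simp flip: nat_pow_consistent)
    qed
  qed
  then have "card (roots G (a * b)) = card ?S"
    by (simp add: bij_betw_same_card)
  also have "\<dots> = (\<Sum>z\<in>roots G b. card (roots (G\<lparr>carrier := centralizer G z\<rparr>) a))"
    using fin by (intro card_SigmaI) (auto simp: roots_def centralizer_def simp flip: nat_pow_consistent)
  finally show ?thesis .
qed

section \<open>Prime powers \<open>q ^ c\<close> containing the full \<open>q\<close>-part of the
  group order\<close>

lemma finite_roots: "finite (carrier G) \<Longrightarrow> finite (roots G n)"
  by (simp add: roots_def)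

lemma one_in_roots: "\<one> \<in> roots G n"
  by (simp add: roots_def)

lemma card_roots_pos: "finite (carrier G) \<Longrightarrow> card (roots G n) > 0"
  using one_in_roots finite_roots by (metis card_gt_0_iff empty_iff)

lemma roots_order_dvd: "order G dvd n \<Longrightarrow> roots G n = carrier G"
  using ord_dvd_group_order by (auto simp: roots_eq_ord intro: dvd_trans)

text \<open>Unlike \<open>roots G n\<close>, the central roots are closed under products, because
  they commute. Their number is thus a group order, to which \<open>coprime_card_exponent\<close>
  applies.\<close>

lemma subgroup_central_roots:
  "subgroup {z \<in> roots G n. centralizer G z = carrier G} G"
proof (rule subgroupI)
  let ?A = "{z \<in> roots G n. centralizer G z = carrier G}"
  have A: "z \<in> ?A \<longleftrightarrow> z \<in> carrier G \<and> z [^] n = \<one> \<and> (\<forall>g\<in>carrier G. g \<otimes> z = z \<otimes> g)" for z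
    by (auto simp: roots_def centralizer_def)
  show "?A \<subseteq> carrier G" using A by blast
  show "?A \<noteq> {}" using A[of \<one>] by auto
  fix a assume "a \<in> ?A"
  then have a: "a \<in> carrier G" "a [^] n = \<one>" "\<And>g. g \<in> carrier G \<Longrightarrow> g \<otimes> a = a \<otimes> g"
    using A by auto
  have "g \<otimes> inv a = inv a \<otimes> g" if g: "g \<in> carrier G" for g
  proof -
    have "a \<in> centralizer G g"
      using a(1) a(3)[OF g] by (simp add: centralizer_def)
    then have "inv a \<in> centralizer G g"
      by (rule subgroup.m_inv_closed[OF subgroup_centralizer[OF g]])
    then show ?thesis by (simp add: centralizer_def)
  qed
  then show "inv a \<in> ?A" unfolding A using a(1,2) by (simp add: nat_pow_inv)
  fix b assume "b \<in> ?A"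
  then have b: "b \<in> carrier G" "b [^] n = \<one>" "\<And>g. g \<in> carrier G \<Longrightarrow> g \<otimes> b = b \<otimes> g"
    using A by auto
  have "g \<otimes> (a \<otimes> b) = a \<otimes> b \<otimes> g" if g: "g \<in> carrier G" for g
  proof -
    have "g \<otimes> (a \<otimes> b) = a \<otimes> (g \<otimes> b)"
      using a(1) a(3)[OF g] b(1) g by (simp flip: m_assoc)
    also have "\<dots> = a \<otimes> b \<otimes> g"
      using a(1) b(1) b(3)[OF g] g by (simp add: m_assoc)
    finally show ?thesis .
  qed
  moreover have "(a \<otimes> b) [^] n = \<one>"
    using pow_mult_distrib[of a b n] b(3)[OF a(1)] a(1,2) b(1,2) by simp
  ultimately show "a \<otimes> b \<in> ?A" unfolding A using a(1) b(1) by simp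
qed

text \<open>Sylow's theorem with exponent 1 acts as Cauchy's theorem: if \<open>q\<close> divided
  \<open>order G\<close>, a non-identity element of a subgroup of order \<open>q\<close> would have
  an order dividing both \<open>q\<close> and \<open>b\<close>.\<close>

lemma coprime_card_exponent:
  assumes fin: "finite (carrier G)" and exp: "\<And>x. x \<in> carrier G \<Longrightarrow> x [^] b = \<one>"
    and q: "Factorial_Ring.prime q" and b: "\<not> q dvd b"
  shows "coprime q (order G)"
proof -
  have "\<not> q dvd order G"
  proof
    assume "q dvd order G"
    then obtain m where "order G = q ^ 1 * m" by auto
    then obtain H where H: "subgroup H G" "card H = q"
      using sylow_thm[OF q is_group _ fin] by (metis power_one_right)
    then have "\<not> H \<subseteq> {\<one>}"
      using q by (metis card_mono card.empty card_insert_disjoint empty_iff finite.intros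
          not_less One_nat_def prime_gt_1_nat)
    then obtain h where h: "h \<in> H" "h \<noteq> \<one>" by blast
    have hG: "h \<in> carrier G" using h H subgroup.subset by blast
    interpret H: group "G\<lparr>carrier := H\<rparr>" by (rule subgroup_imp_group[OF H(1)])
    have "h [^] q = \<one>"
      using H.pow_order_eq_1[of h] h H by (simp add: order_def flip: nat_pow_consistent)
    then have "local.ord h dvd q" "local.ord h dvd b"
      using exp[OF hG] hG by (auto simp: pow_eq_id)
    then have "local.ord h = 1"
      using q b by (metis prime_nat_iff)
    then show False using h hG ord_eq_1 by blast
  qed
  then show ?thesis using q prime_imp_coprime by blast
qed

text \<open>Splitting all of \<open>G\<close> into \<open>q\<close>-parts and \<open>q'\<close>-parts, the non-central \<open>q'\<close>-parts contribute
  multiples of the \<open>q\<close>-part of \<open>|G|\<close>, so the central ones, whose number is coprime to \<open>q\<close>, do so too.\<close>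
lemma gcd_dvd_card_roots_if_centralizers:
  assumes fin: "finite (carrier G)" and q: "Factorial_Ring.prime q" and c: "\<not> q ^ Suc c dvd order G"
    and centralizers: "\<And>z. z \<in> carrier G \<Longrightarrow> centralizer G z \<noteq> carrier G \<Longrightarrow>
      gcd (q ^ c) (card (centralizer G z)) dvd card (roots (G\<lparr>carrier := centralizer G z\<rparr>) (q ^ c))"
  shows "gcd (q ^ c) (order G) dvd card (roots G (q ^ c))"
proof -
  let ?C = "\<lambda>z. G\<lparr>carrier := centralizer G z\<rparr>"
  have ord0: "order G \<noteq> 0" using fin order_gt_0_iff_finite by simp
  \<comment> \<open>\<open>q ^ j\<close> is the exact \<open>q\<close>-part of the group order and
    \<open>b\<close> its cofactor; the gcd in the goal equals \<open>q ^ j\<close>.\<close>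
  obtain j b where jb: "order G = q ^ j * b" "\<not> q dvd b"
    using multiplicity_decompose'[OF ord0, of q] q not_prime_unit by metis
  have "j \<le> c"
    using c jb(1) by (metis dvd_mult2 le_imp_power_dvd not_less_eq_eq)
  have cop: "coprime q b" using q jb(2) prime_imp_coprime by blast
  then have d: "gcd (q ^ c) (order G) = q ^ j"
    using \<open>j \<le> c\<close> jb(1) by (metis coprime_power_left_iff gcd_mult_left_right_cancel gcd_nat.absorb2 gcd.commute le_imp_power_dvd)
  let ?F = "\<lambda>z. card (roots (?C z) (q ^ c))"
  \<comment> \<open>Extension by zero turns the non-central contribution into a class function on
    the whole carrier.\<close>
  let ?f = "\<lambda>z. if z \<in> roots G b \<and> centralizer G z \<noteq> carrier G then ?F z else 0"
  let ?A = "{z \<in> roots G b. centralizer G z = carrier G}"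
  have "order G = card (roots G (q ^ c * b))"
    using roots_order_dvd[of "q ^ c * b"] jb(1) \<open>j \<le> c\<close>
    by (simp add: order_def le_imp_power_dvd mult_dvd_mono)
  also have "\<dots> = (\<Sum>z\<in>roots G b. ?F z)"
    using cop by (intro card_roots_coprime_mult fin) simp
  also have "\<dots> = (\<Sum>z\<in>?A. ?F z) + (\<Sum>z\<in>{z \<in> roots G b. centralizer G z \<noteq> carrier G}. ?F z)"
    by (subst sum.union_disjoint[symmetric]) (auto intro: sum.cong simp: finite_roots fin)
  also have "(\<Sum>z\<in>{z \<in> roots G b. centralizer G z \<noteq> carrier G}. ?F z) = (\<Sum>z\<in>carrier G. ?f z)"
    using fin by (intro sum.mono_neutral_cong_left) (auto simp: roots_def)
  \<comment> \<open>For central \<open>z\<close> the centralizer is all of \<open>G\<close>, so the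
    summand is constant.\<close>
  also have "(\<Sum>z\<in>?A. ?F z) = card ?A * card (roots G (q ^ c))"
    by simp
  finally have sum: "order G = card ?A * card (roots G (q ^ c)) + (\<Sum>z\<in>carrier G. ?f z)" .
  have nc: "q ^ j dvd (\<Sum>z\<in>carrier G. ?f z)"
  proof (rule dvd_sum_class_function[OF fin])
    show "q ^ j dvd order G" using jb by simp
  next
    fix g x assume gx: "g \<in> carrier G" "x \<in> carrier G"
    have "centralizer G (g \<otimes> x \<otimes> inv g) = carrier G \<longleftrightarrow> centralizer G x = carrier G"
    proof -
      have "centralizer G x = carrier G \<longleftrightarrow> (\<forall>y\<in>carrier G. y \<in> centralizer G x)" for x
        by (auto simp: centralizer_def)
      \<comment> \<open>Conjugation by \<open>g\<close> permutes the carrier, so \<open>y\<close>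
        may be replaced by its conjugate under the quantifier.\<close>
      moreover have "(\<forall>y\<in>carrier G. y \<in> centralizer G (g \<otimes> x \<otimes> inv g)) \<longleftrightarrow>
          (\<forall>y\<in>carrier G. g \<otimes> y \<otimes> inv g \<in> centralizer G (g \<otimes> x \<otimes> inv g))"
        by (subst bij_betw_imp_surj_on[OF bij_betw_conj[OF gx(1)], symmetric]) simp
      ultimately show ?thesis using gx by (simp add: conj_in_centralizer_iff)
    qed
    then show "?f (g \<otimes> x \<otimes> inv g) = ?f x"
      using gx by (simp add: conj_in_roots_iff card_centralizer_roots_conj)
  next
    fix x assume x: "x \<in> carrier G"
    have "gcd (q ^ j) (card (centralizer G x)) dvd gcd (q ^ c) (card (centralizer G x))"
      using \<open>j \<le> c\<close> by (intro gcd_mono) (simp_all add: le_imp_power_dvd)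
    then have "gcd (q ^ j) (card (centralizer G x)) dvd ?F x" if "centralizer G x \<noteq> carrier G"
      using centralizers[OF x that] dvd_trans by blast
    then show "gcd (q ^ j) (card (centralizer G x)) dvd ?f x" by simp
  qed
  have "q ^ j dvd order G" using jb by simp
  then have "q ^ j dvd card ?A * card (roots G (q ^ c))"
    by (subst (asm) sum) (rule iffD1[OF dvd_add_left_iff[OF nc]])
  \<comment> \<open>\<open>?A\<close> is a group in which every element is killed by
    \<open>b\<close>, and \<open>q\<close> does not divide \<open>b\<close>.\<close>
  moreover have "coprime (q ^ j) (card ?A)"
  proof -
    interpret A: group "G\<lparr>carrier := ?A\<rparr>"
      by (rule subgroup_imp_group[OF subgroup_central_roots])
    have "coprime q (order (G\<lparr>carrier := ?A\<rparr>))"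
      by (rule A.coprime_card_exponent[OF _ _ q jb(2)])
         (auto simp: finite_roots fin, auto simp: roots_def simp flip: nat_pow_consistent)
    then show ?thesis by (simp add: order_def)
  qed
  ultimately show ?thesis
    unfolding d using coprime_dvd_mult_right_iff by blast
qed

end

text \<open>Induction on the group order: a proper centralizer is smaller, and its order divides
  \<open>order G\<close>, so \<open>q ^ Suc c\<close> does not divide it either. The gcd lets
  \<open>c\<close> stay fixed although \<open>q ^ c\<close> may fail to divide the smaller
  order.\<close>

lemma gcd_dvd_card_roots_full_prime_power:
  assumes "group G" "finite (carrier G)" "Factorial_Ring.prime q" "\<not> q ^ Suc c dvd order G"
  shows "gcd (q ^ c) (order G) dvd card (roots G (q ^ c))"
  using assms
proof (induction "order G" arbitrary: G rule: less_induct)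
  case (less G)
  interpret group G by fact
  note fin = less.prems(2) and q = less.prems(3)
  show ?case
  proof (rule gcd_dvd_card_roots_if_centralizers[OF fin q less.prems(4)])
    fix z assume z: "z \<in> carrier G" and ne: "centralizer G z \<noteq> carrier G"
    let ?C = "G\<lparr>carrier := centralizer G z\<rparr>"
    have "centralizer G z \<subset> carrier G" using ne by (auto simp: centralizer_def)
    then have "order ?C < order G"
      using fin by (simp add: order_def psubset_card_mono)
    moreover have "finite (carrier ?C)"
      using fin by (simp add: centralizer_def)
    moreover have "order ?C dvd order G"
      using lagrange[OF subgroup_centralizer[OF z]] unfolding order_def by (simp, metis dvd_triv_right)
    then have "\<not> q ^ Suc c dvd order ?C"
      using less.prems(4) dvd_trans by blast
    ultimately have "gcd (q ^ c) (order ?C) dvd card (roots ?C (q ^ c))"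
      using less.hyps[OF _ group_centralizer[OF z] _ q] by blast
    then show "gcd (q ^ c) (card (centralizer G z)) dvd card (roots ?C (q ^ c))"
      by (simp add: order_def)
  qed
qed

section \<open>Elements of a given order, cyclic subgroups and Frobenius' theorem\<close>

context group
begin

abbreviation "elements_of_order d \<equiv> {x \<in> carrier G. local.ord x = d}"
abbreviation "cyclic_subgroups d \<equiv> {H. subgroup H G \<and> cyclic_group (G\<lparr>carrier := H\<rparr>) \<and> card H = d}"

lemma card_roots_sum:
  assumes "finite (carrier G)" "n > 0"
  shows "card (roots G n) = (\<Sum>d | d dvd n. card (elements_of_order d))"
proof -
  have "roots G n = (\<Union>d\<in>{d. d dvd n}. elements_of_order d)"
    by (auto simp: roots_eq_ord)
  then show ?thesis
    using assms by (auto intro!: card_UN_disjoint)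
qed

text \<open>A generator inside \<open>H\<close> also generates \<open>H\<close> inside
  \<open>G\<close> by \<open>generate_consistent\<close>, so cyclic subgroups can be counted through
  their generators.\<close>

lemma cyclic_subgroups_eq:
  "cyclic_subgroups d = (\<lambda>x. generate G {x}) ` elements_of_order d"
proof (intro subset_antisym subsetI)
  fix H assume "H \<in> cyclic_subgroups d"
  then have H: "subgroup H G" "cyclic_group (G\<lparr>carrier := H\<rparr>)" "card H = d" by auto
  then obtain x where x: "x \<in> H" "subgroup_generated (G\<lparr>carrier := H\<rparr>) {x} = G\<lparr>carrier := H\<rparr>"
    by (auto simp: cyclic_group_def)
  then have "generate (G\<lparr>carrier := H\<rparr>) {x} = H"
    by (metis carrier_subgroup_generated Int_insert_right_if1 inf_bot_right
        partial_object.select_convs(1) partial_object.surjective partial_object.update_convs(1))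
  then have "generate G {x} = H"
    using generate_consistent[of "{x}" H] x H by simp
  moreover have "x \<in> carrier G" using x H subgroup.subset by blast
  ultimately show "H \<in> (\<lambda>x. generate G {x}) ` elements_of_order d"
    using H generate_pow_card by auto
next
  fix H assume "H \<in> (\<lambda>x. generate G {x}) ` elements_of_order d"
  then obtain x where x: "x \<in> carrier G" "local.ord x = d" "H = generate G {x}" by auto
  then have "subgroup_generated G {x} = G\<lparr>carrier := H\<rparr>"
    by (simp add: subgroup_generated_def)
  then have "cyclic_group (G\<lparr>carrier := H\<rparr>)"
    by (metis cyclic_group_generated)
  then show "H \<in> cyclic_subgroups d"
    using x generate_is_subgroup[of "{x}"] generate_pow_card[of x] by simp
qed

text \<open>The generators are the powers \<open>x [^] k\<close> with \<open>k\<close> coprime to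
  the order of \<open>x\<close>, and distinct totatives give distinct powers.\<close>

lemma card_generators:
  assumes fin: "finite (carrier G)" and x: "x \<in> carrier G"
  shows "card {y \<in> carrier G. generate G {y} = generate G {x}} = totient (local.ord x)"
proof -
  let ?o = "local.ord x"
  have pos: "?o \<ge> 1" by (rule ord_ge_1[OF fin x])
  have "{y \<in> carrier G. generate G {y} = generate G {x}} = (\<lambda>k. x [^] k) ` totatives ?o"
  proof (intro subset_antisym subsetI)
    fix y assume "y \<in> {y \<in> carrier G. generate G {y} = generate G {x}}"
    then have y: "y \<in> carrier G" "generate G {y} = generate G {x}" by auto
    then have "y \<in> generate G {x}" by (metis generate.incl singletonI)
    then obtain k :: nat where k: "y = x [^] k"
      using generate_pow_on_finite_carrier[OF fin x] by auto
    have "local.ord y = ?o" using y x generate_pow_card by metis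
    then have cop: "coprime k ?o" using pow_ord_eq_ord_iff[OF fin x] k by simp
    show "y \<in> (\<lambda>k. x [^] k) ` totatives ?o"
    \<comment> \<open>The only totative of 1 is 1, whereas reduction modulo 1 gives 0; hence the
      separate case.\<close>
    proof (cases "?o = 1")
      case True
      then have "x = \<one>" using x ord_eq_1 by blast
      then have "y = x [^] (1::nat)" using k by simp
      then show ?thesis using True by auto
    next
      case False
      have "x [^] k = x [^] (?o * (k div ?o) + k mod ?o)" by simp
      also have "\<dots> = x [^] (?o * (k div ?o)) \<otimes> x [^] (k mod ?o)"
        using x by (simp only: nat_pow_mult)
      also have "x [^] (?o * (k div ?o)) = \<one>"
        using x by (simp add: pow_eq_id)
      finally have "y = x [^] (k mod ?o)" using x k by simp
      moreover have "k mod ?o \<in> totatives ?o"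
        using cop False pos by (auto simp: in_totatives_iff mod_greater_zero_iff_not_dvd order.order_iff_strict)
      ultimately show ?thesis by blast
    qed
  next
    fix y assume "y \<in> (\<lambda>k. x [^] k) ` totatives ?o"
    then obtain k where k: "y = x [^] k" "coprime k ?o" by (auto simp: in_totatives_iff)
    have y: "y \<in> carrier G" using k x by simp
    have "y \<in> generate G {x}" using k generate_pow_on_finite_carrier[OF fin x] by auto
    then have sub: "generate G {y} \<subseteq> generate G {x}"
      using x generate_is_subgroup[of "{x}"] by (intro generate_subgroup_incl) auto
    have "card (generate G {y}) = card (generate G {x})"
      using pow_ord_eq_ord_iff[OF fin x] k x y by (simp flip: generate_pow_card)
    moreover have "finite (generate G {x})"
      using fin x generate_incl by (metis empty_subsetI finite_subset insert_subset)
    ultimately have "generate G {y} = generate G {x}"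
      using sub card_subset_eq by blast
    then show "y \<in> {y \<in> carrier G. generate G {y} = generate G {x}}" using y by simp
  qed
  moreover have "inj_on (\<lambda>k. x [^] k) (totatives ?o)"
    by (rule inj_on_subset[OF ord_inj'[OF x]]) (auto simp: in_totatives_iff)
  ultimately show ?thesis by (simp add: card_image totient_def)
qed

text \<open>The map sending an element to the subgroup it generates has fibres of size
  \<open>totient d\<close> over the cyclic subgroups of order \<open>d\<close>.\<close>

lemma card_elements_of_order:
  assumes fin: "finite (carrier G)"
  shows "card (elements_of_order d) = card (cyclic_subgroups d) * totient d"
proof -
  let ?fib = "\<lambda>H. {y \<in> carrier G. generate G {y} = H}"
  have ord_eq: "local.ord y = local.ord x" if "x \<in> carrier G" "y \<in> carrier G" "generate G {y} = generate G {x}" for x y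
    using that generate_pow_card by metis
  have fin': "finite (cyclic_subgroups d)" unfolding cyclic_subgroups_eq using fin by simp
  have "elements_of_order d = (\<Union>H\<in>cyclic_subgroups d. ?fib H)"
    unfolding cyclic_subgroups_eq using ord_eq by auto
  then have "card (elements_of_order d) = (\<Sum>H\<in>cyclic_subgroups d. card (?fib H))"
    using fin fin' by (simp only:) (rule card_UN_disjoint, auto)
  also have "\<dots> = (\<Sum>H\<in>cyclic_subgroups d. totient d)"
    unfolding cyclic_subgroups_eq using card_generators[OF fin] by (intro sum.cong) auto
  finally show ?thesis by simp
qed

text \<open>If \<open>q ^ k\<close> is smaller than the \<open>q\<close>-part \<open>q ^ c\<close>
  of the order, the count for \<open>q ^ c\<close> is already divisible by \<open>q ^ k\<close>. The
  elements to be discarded have orders \<open>q ^ i\<close> with \<open>i > k\<close>, and their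
  number is a multiple of \<open>totient (q ^ i)\<close>.\<close>

lemma gcd_dvd_card_roots_prime_power:
  assumes fin: "finite (carrier G)" and q: "Factorial_Ring.prime q"
  shows "gcd (q ^ k) (order G) dvd card (roots G (q ^ k))"
proof (cases "q ^ Suc k dvd order G")
  case False
  then show ?thesis using gcd_dvd_card_roots_full_prime_power[OF is_group fin q] by blast
next
  case True
  have ord0: "order G \<noteq> 0" using fin order_gt_0_iff_finite by simp
  define c where "c = multiplicity q (order G)"
  have kc: "k \<le> c"
    using True ord0 q unfolding c_def by (metis Suc_leD multiplicity_geI not_prime_unit)
  have "q ^ k dvd order G" using True by (rule power_le_dvd) simp
  have "\<not> q ^ Suc c dvd order G"
    using ord0 q unfolding c_def by (metis multiplicity_geI not_less_eq_eq not_prime_unit order_refl)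
  then have "gcd (q ^ c) (order G) dvd card (roots G (q ^ c))"
    by (rule gcd_dvd_card_roots_full_prime_power[OF is_group fin q])
  moreover have "q ^ k dvd gcd (q ^ c) (order G)"
    using kc \<open>q ^ k dvd order G\<close> by (simp add: le_imp_power_dvd)
  ultimately have "q ^ k dvd card (roots G (q ^ c))" by (rule dvd_trans[rotated])
  also have "card (roots G (q ^ c)) = (\<Sum>d | d dvd q ^ c. card (elements_of_order d))"
    using q by (intro card_roots_sum fin) (simp add: prime_gt_0_nat)
  also have "\<dots> = (\<Sum>d\<in>{d. d dvd q ^ k} \<union> {d. d dvd q ^ c \<and> \<not> d dvd q ^ k}. card (elements_of_order d))"
    using kc by (intro sum.cong) (auto intro: dvd_trans le_imp_power_dvd)
  also have "\<dots> = (\<Sum>d | d dvd q ^ k. card (elements_of_order d)) +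
      (\<Sum>d | d dvd q ^ c \<and> \<not> d dvd q ^ k. card (elements_of_order d))"
    using q by (intro sum.union_disjoint) (auto simp: prime_gt_0_nat)
  also have "(\<Sum>d | d dvd q ^ k. card (elements_of_order d)) = card (roots G (q ^ k))"
    using q by (intro card_roots_sum[symmetric] fin) (simp add: prime_gt_0_nat)
  finally have sum: "q ^ k dvd card (roots G (q ^ k)) +
      (\<Sum>d | d dvd q ^ c \<and> \<not> d dvd q ^ k. card (elements_of_order d))" .
  have "q ^ k dvd (\<Sum>d | d dvd q ^ c \<and> \<not> d dvd q ^ k. card (elements_of_order d))"
  proof (rule dvd_sum)
    fix d assume "d \<in> {d. d dvd q ^ c \<and> \<not> d dvd q ^ k}"
    then have d: "d dvd q ^ c" "\<not> d dvd q ^ k" by auto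
    obtain i where i: "d = q ^ i" using d(1) q divides_primepow_nat by blast
    \<comment> \<open>\<open>totient (q ^ i)\<close> contains only \<open>q ^ (i - 1)\<close>, so
      the strict inequality is just enough for \<open>q ^ k\<close>.\<close>
    have "k < i" using d(2) i le_imp_power_dvd by (metis not_le)
    then have "q ^ k dvd totient d"
      using q i by (simp add: totient_prime_power le_imp_power_dvd)
    then show "q ^ k dvd card (elements_of_order d)"
      by (simp add: card_elements_of_order[OF fin])
  qed
  then have "q ^ k dvd card (roots G (q ^ k))"
    using sum dvd_add_left_iff by blast
  then show ?thesis by (meson dvd_trans gcd_dvd1)
qed

text \<open>One prime at a time: for \<open>n = q ^ k * b\<close> the count is a sum of a class
  function over the roots of exponent \<open>b\<close>, and the prime-power case in each centralizer
  supplies the gcd condition.\<close>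

theorem frobenius_dvd_card_roots:
  assumes fin: "finite (carrier G)" and n: "n dvd order G"
  shows "n dvd card (roots G n)"
proof (rule multiplicity_le_imp_dvd)
  have ord0: "order G \<noteq> 0" using fin order_gt_0_iff_finite by simp
  then show n0: "n \<noteq> 0" using n by auto
  fix q :: nat assume q: "Factorial_Ring.prime q"
  obtain b where b: "n = q ^ multiplicity q n * b" "\<not> q dvd b"
    using multiplicity_decompose'[OF n0, of q] q not_prime_unit by metis
  define k where "k = multiplicity q n"
  have cop: "coprime (q ^ k) b" using q b prime_imp_coprime by auto
  let ?C = "\<lambda>z. G\<lparr>carrier := centralizer G z\<rparr>"
  let ?f = "\<lambda>z. if z \<in> roots G b then card (roots (?C z) (q ^ k)) else 0"
  have "card (roots G n) = (\<Sum>z\<in>roots G b. card (roots (?C z) (q ^ k)))"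
    using card_roots_coprime_mult[OF fin cop] b(1) by (simp add: k_def)
  also have "\<dots> = (\<Sum>z\<in>carrier G. ?f z)"
    using fin by (intro sum.mono_neutral_cong_left) (auto simp: roots_def)
  finally have sum: "card (roots G n) = (\<Sum>z\<in>carrier G. ?f z)" .
  have "q ^ k dvd (\<Sum>z\<in>carrier G. ?f z)"
  proof (rule dvd_sum_class_function[OF fin])
    show "q ^ k dvd order G" using n b(1) unfolding k_def by (metis dvd_mult_left)
    show "?f (g \<otimes> x \<otimes> inv g) = ?f x" if "g \<in> carrier G" "x \<in> carrier G" for g x
      using that by (simp add: conj_in_roots_iff card_centralizer_roots_conj)
    show "gcd (q ^ k) (card (centralizer G x)) dvd ?f x" if x: "x \<in> carrier G" for x
    proof -
      interpret C: group "?C x" by (rule group_centralizer[OF x])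
      have "finite (carrier (?C x))" using fin by (simp add: centralizer_def)
      then show ?thesis using C.gcd_dvd_card_roots_prime_power[OF _ q, of k] by (simp add: order_def)
    qed
  qed
  then have "q ^ k dvd card (roots G n)" using sum by simp
  moreover have "card (roots G n) \<noteq> 0" using card_roots_pos[OF fin] by simp
  ultimately show "multiplicity q n \<le> multiplicity q (card (roots G n))"
    using q unfolding k_def by (intro multiplicity_geI) (auto simp: not_prime_unit)
qed

end

section \<open>Moebius inversion of a multiplicative function\<close>

text \<open>The Moebius inverse of \<open>f\<close> over the divisors of \<open>n\<close> that are
  multiples of a given one, in product form so that its sign can be read off factor by factor. The
  value 0 cuts \<open>f\<close> off beyond the divisors of \<open>n\<close>.\<close>

definition divisor_weight :: "(nat \<Rightarrow> real) \<Rightarrow> nat \<Rightarrow> nat \<Rightarrow> real" where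
  "divisor_weight f n m = (\<Prod>p\<in>prime_factors n. f (p ^ multiplicity p m) -
     (if p ^ Suc (multiplicity p m) dvd n then f (p ^ Suc (multiplicity p m)) else 0))"

text \<open>Primes \<open>q\<close> other than \<open>p\<close> do not see the powers of
  \<open>p\<close>, so exactly one factor splits off. This is what the induction in
  \<open>sum_divisor_weight\<close> consumes.\<close>

lemma divisor_weight_prime_power_mult:
  assumes p: "Factorial_Ring.prime p" and "\<not> p dvd n" "n > 0" "m dvd n" "k \<le> a" "a > 0"
  shows "divisor_weight f (p ^ a * n) (p ^ k * m) =
    (f (p ^ k) - (if Suc k \<le> a then f (p ^ Suc k) else 0)) * divisor_weight f n m"
proof -
  have p0: "p \<noteq> 0" using p by auto
  have m: "m > 0" "\<not> p dvd m" using assms by (auto intro: Nat.gr0I dvd_trans)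
  have pf: "prime_factors (p ^ a * n) = insert p (prime_factors n)"
    using assms p0 by (subst prime_factors_product) (auto simp: prime_factors_power prime_prime_factors)
  have "p \<notin> prime_factors n" using assms by (auto simp: prime_factors_dvd)
  moreover have "multiplicity p (p ^ k * m) = k"
    using p m by (intro multiplicity_eqI) (auto simp: p0)
  moreover have "p ^ Suc k dvd p ^ a * n \<longleftrightarrow> Suc k \<le> a"
  proof -
    have "coprime (p ^ Suc k) n" using p assms prime_imp_coprime by auto
    then have "p ^ Suc k dvd p ^ a * n \<longleftrightarrow> p ^ Suc k dvd p ^ a"
      by (rule coprime_dvd_mult_left_iff)
    also have "\<dots> \<longleftrightarrow> Suc k \<le> a"
      using p by (metis dvd_power_iff_le prime_ge_2_nat)
    finally show ?thesis .
  qed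
  moreover have "f (q ^ multiplicity q (p ^ k * m)) -
      (if q ^ Suc (multiplicity q (p ^ k * m)) dvd p ^ a * n then f (q ^ Suc (multiplicity q (p ^ k * m))) else 0) =
      f (q ^ multiplicity q m) - (if q ^ Suc (multiplicity q m) dvd n then f (q ^ Suc (multiplicity q m)) else 0)"
    if q: "q \<in> prime_factors n" for q
  proof -
    have q': "Factorial_Ring.prime q" "q \<noteq> p" using q assms by (auto simp: prime_factors_dvd)
    then have "coprime q p" using p primes_coprime by blast
    then have "\<not> q dvd p ^ k" using q' by (metis coprime_power_right_iff coprime_absorb_left not_prime_unit)
    then have "multiplicity q (p ^ k * m) = multiplicity q m"
      using q' m p0 by (simp add: prime_elem_multiplicity_mult_distrib not_dvd_imp_multiplicity_0)
    moreover have "q ^ i dvd p ^ a * n \<longleftrightarrow> q ^ i dvd n" for i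
      using \<open>coprime q p\<close> by (intro coprime_dvd_mult_right_iff) simp
    ultimately show ?thesis by (simp del: power_Suc)
  qed
  ultimately show ?thesis
    unfolding divisor_weight_def pf by (subst prod.insert) (auto simp del: power_Suc)
qed

text \<open>Moebius inversion over the divisors of \<open>n\<close>, as a product of telescoping sums.\<close>
lemma sum_divisor_weight:
  fixes f :: "nat \<Rightarrow> real"
  assumes one: "f 1 = 1" and mult: "\<And>a b. coprime a b \<Longrightarrow> f (a * b) = f a * f b"
    and "n > 0" "d dvd n"
  shows "(\<Sum>m | d dvd m \<and> m dvd n. divisor_weight f n m) = f d"
  using assms(3,4)
proof (induction n arbitrary: d rule: less_induct)
  case (less n)
  show ?case
  proof (cases "n = 1")
    case True
    then have "{m. d dvd m \<and> m dvd n} = {1}" "d = 1" using less.prems by auto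
    then show ?thesis using True one by (simp add: divisor_weight_def)
  next
    case False
    then obtain p where p: "Factorial_Ring.prime p" "p dvd n" using prime_factor_nat by blast
    have pu: "\<not> is_unit p" using p not_prime_unit by blast
    define a where "a = multiplicity p n"
    obtain n' where n': "n = p ^ a * n'" "\<not> p dvd n'"
      using multiplicity_decompose'[of n p] less.prems pu unfolding a_def by auto
    have d0: "d > 0" using less.prems by (auto intro: Nat.gr0I)
    define j where "j = multiplicity p d"
    obtain d' where d': "d = p ^ j * d'" "\<not> p dvd d'"
      using multiplicity_decompose'[of d p] d0 pu unfolding j_def by auto
    have "a > 0" using n' p by (metis dvd_mult_unit_iff gr0I is_unit_mult_iff mult_1 power_0)
    have n'0: "n' > 0" using n' less.prems by (auto intro: Nat.gr0I)
    have "n' < n" using n' \<open>a > 0\<close> n'0 p(1) by (metis One_nat_def mult_1 mult_less_mono1 one_less_power prime_gt_1_nat)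
    have cop: "coprime (p ^ k) m" if "\<not> p dvd m" for k m
      using that p prime_imp_coprime by auto
    \<comment> \<open>Divisibility separates into the exponent of \<open>p\<close> and the cofactor,
      which identifies the divisors between \<open>d\<close> and \<open>n\<close> with the product
      set \<open>?S\<close>.\<close>
    have pp_dvd: "p ^ k * u dvd p ^ l * v \<longleftrightarrow> k \<le> l \<and> u dvd v" if "\<not> p dvd u" "\<not> p dvd v" for k l u v
    proof
      assume *: "p ^ k * u dvd p ^ l * v"
      have "p ^ k dvd p ^ l" using * cop[OF that(2), of k] by (metis coprime_dvd_mult_left_iff dvd_mult_left)
      moreover have "u dvd v"
        using * cop[OF that(1), of l] by (metis coprime_commute coprime_dvd_mult_right_iff dvd_mult_right)
      ultimately show "k \<le> l \<and> u dvd v"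
        using p by (metis dvd_power_iff_le prime_ge_2_nat)
    qed (simp add: le_imp_power_dvd mult_dvd_mono)
    have ja: "j \<le> a" "d' dvd n'"
      using less.prems(2) pp_dvd[OF d'(2) n'(2)] unfolding n'(1) d'(1) by auto
    let ?S = "{j..a} \<times> {m. d' dvd m \<and> m dvd n'}"
    have ndvd: "\<not> p dvd m" if "m dvd n'" for m using that n' dvd_trans by blast
    have bij: "bij_betw (\<lambda>(k, m). p ^ k * m) ?S {m. d dvd m \<and> m dvd n}"
      unfolding bij_betw_def
    proof
      show "inj_on (\<lambda>(k, m). p ^ k * m) ?S"
      proof (rule inj_onI, clarify)
        fix k u l v assume *: "u dvd n'" "v dvd n'" "p ^ k * u = p ^ l * v"
        then have "p ^ k * u dvd p ^ l * v" "p ^ l * v dvd p ^ k * u" by simp_all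
        then show "k = l \<and> u = v"
          using pp_dvd[of u v k l] pp_dvd[of v u l k] ndvd * by (auto intro: dvd_antisym)
      qed
      show "(\<lambda>(k, m). p ^ k * m) ` ?S = {m. d dvd m \<and> m dvd n}"
      proof (intro subset_antisym subsetI)
        fix m assume "m \<in> (\<lambda>(k, m). p ^ k * m) ` ?S"
        then show "m \<in> {m. d dvd m \<and> m dvd n}"
          using pp_dvd d' n' ndvd by auto
      next
        fix m assume "m \<in> {m. d dvd m \<and> m dvd n}"
        then have m: "d dvd m" "m dvd n" by auto
        then have "m \<noteq> 0" using less.prems by auto
        then obtain u where u: "m = p ^ multiplicity p m * u" "\<not> p dvd u"
          using multiplicity_decompose' pu by metis
        have "j \<le> multiplicity p m \<and> d' dvd u" "multiplicity p m \<le> a \<and> u dvd n'"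
          using m pp_dvd[OF d'(2) u(2)] pp_dvd[OF u(2) n'(2)] u(1) d'(1) n'(1) by metis+
        then have "(multiplicity p m, u) \<in> ?S" by simp
        then show "m \<in> (\<lambda>(k, m). p ^ k * m) ` ?S" using u(1) by (metis (no_types, lifting) case_prod_conv image_eqI)
      qed
    qed
    \<comment> \<open>The cutoff makes \<open>?g (Suc a)\<close> zero, so the telescoping sum leaves
      only \<open>f (p ^ j)\<close>.\<close>
    let ?g = "\<lambda>k. if k \<le> a then f (p ^ k) else 0"
    have "(\<Sum>m | d dvd m \<and> m dvd n. divisor_weight f n m) =
        (\<Sum>(k, m)\<in>?S. divisor_weight f n (p ^ k * m))"
      by (subst sum.reindex_bij_betw[OF bij, symmetric]) (simp add: case_prod_unfold)
    also have "\<dots> = (\<Sum>(k, m)\<in>?S. (?g k - ?g (Suc k)) * divisor_weight f n' m)"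
    proof (rule sum.cong[OF refl], clarify)
      fix k m assume "k \<in> {j..a}" "m dvd n'"
      then show "divisor_weight f n (p ^ k * m) = (?g k - ?g (Suc k)) * divisor_weight f n' m"
        using divisor_weight_prime_power_mult[OF p(1) n'(2) n'0 \<open>m dvd n'\<close> _ \<open>a > 0\<close>, of k f] n'(1)
        by (simp del: power_Suc)
    qed
    also have "\<dots> = (\<Sum>k=j..a. ?g k - ?g (Suc k)) * (\<Sum>m | d' dvd m \<and> m dvd n'. divisor_weight f n' m)"
      by (simp only: sum_product sum.cartesian_product)
    also have "(\<Sum>k=j..a. ?g k - ?g (Suc k)) = f (p ^ j)"
      using sum_Suc_diff[of j a "\<lambda>k. - ?g k"] ja by simp
    also have "(\<Sum>m | d' dvd m \<and> m dvd n'. divisor_weight f n' m) = f d'"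
      by (rule less.IH[OF \<open>n' < n\<close> n'0 ja(2)])
    finally show ?thesis
      using mult[OF cop[OF d'(2), of j]] d'(1) by simp
  qed
qed

section \<open>The weight of an element order and its decrease along prime powers\<close>

definition order_weight :: "real \<Rightarrow> real \<Rightarrow> nat \<Rightarrow> real" where
  "order_weight r s d = real d powr s / real (totient d) powr r"

lemma order_weight_mult:
  "coprime a b \<Longrightarrow> order_weight r s (a * b) = order_weight r s a * order_weight r s b"
  by (simp add: order_weight_def totient_mult_coprime powr_mult)

lemma order_weight_one: "order_weight r s 1 = 1"
  by (simp add: order_weight_def)

lemma order_weight_pos: "d > 0 \<Longrightarrow> order_weight r s d > 0"
  by (simp add: order_weight_def)

text \<open>For \<open>k > 0\<close> both the number and its totient grow by exactly the factor
  \<open>p\<close>, so the weight is multiplied by \<open>p\<close> to the power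
  \<open>s - r\<close>. The step from 1 to \<open>p\<close> behaves differently.\<close>

lemma order_weight_prime_power_less:
  assumes p: "Factorial_Ring.prime p" and "s < r" "k > 0"
  shows "order_weight r s (p ^ Suc k) < order_weight r s (p ^ k)"
proof -
  have p1: "real p > 1" using p prime_gt_1_nat by simp
  have "totient (p ^ Suc k) = p * totient (p ^ k)"
    using \<open>k > 0\<close> gr0_implies_Suc[of k] by (auto simp: totient_power_Suc simp del: power_Suc) simp
  then have "order_weight r s (p ^ Suc k) = order_weight r s (p ^ k) * (real p powr s / real p powr r)"
    by (simp add: order_weight_def powr_mult mult.commute)
  moreover have "real p powr s / real p powr r < 1"
    using p1 \<open>s < r\<close> by simp
  moreover have "order_weight r s (p ^ k) > 0"
    using p by (intro order_weight_pos) (simp add: prime_gt_0_nat)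
  ultimately show ?thesis
    by (metis mult.right_neutral mult_strict_left_mono)
qed

text \<open>The claim amounts to \<open>p powr s < (p - 1) powr r\<close>. At \<open>p = 2\<close>
  the right side is 1, so \<open>s = 0\<close> would give equality there.\<close>

lemma order_weight_prime_less_one:
  assumes p: "Factorial_Ring.prime p" and "s < r" "s \<le> 0" and "p \<noteq> 2 \<or> s \<noteq> 0"
  shows "order_weight r s p < 1"
proof -
  have p1: "p > 1" using p prime_gt_1_nat by simp
  have tot: "real (totient p) = real p - 1" using p p1 by (simp add: totient_prime of_nat_diff)
  have "real p powr s < (real p - 1) powr r"
  proof (cases "p = 2")
    case True
    then have "s < 0" using assms by auto
    then show ?thesis using True powr_less_mono[of s 0 2] by simp
  next
    case False
    then have p2: "real p - 1 > 1" using p1 by linarith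
    \<comment> \<open>For negative \<open>r\<close> the comparison passes through
      \<open>p powr r\<close>, otherwise through 1. If \<open>s = 0\<close>, then
      \<open>r > 0\<close> and the right side exceeds 1.\<close>
    consider "r < 0" | "r \<ge> 0" "s < 0" | "s = 0" using \<open>s \<le> 0\<close> by linarith
    then show ?thesis
    proof cases
      case 1
      have "real p powr s < real p powr r" using p1 \<open>s < r\<close> by simp
      also have "\<dots> \<le> (real p - 1) powr r" using 1 p2 by (intro powr_mono2') auto
      finally show ?thesis .
    next
      case 2
      have "real p powr s < 1" using 2 p1 powr_less_mono[of s 0 "real p"] by simp
      also have "\<dots> \<le> (real p - 1) powr r" using 2 p2 by (simp add: ge_one_powr_ge_zero)
      finally show ?thesis .
    next
      case 3
      then show ?thesis using p1 p2 \<open>s < r\<close> powr_less_mono[of 0 r "real p - 1"] by simp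
    qed
  qed
  then show ?thesis using p1 by (simp add: order_weight_def tot)
qed

lemma order_weight_prime_power_le:
  assumes p: "Factorial_Ring.prime p" and "s < r" "s \<le> 0"
  shows "order_weight r s (p ^ Suc k) \<le> order_weight r s (p ^ k)"
proof (cases "k = 0")
  case True
  have "order_weight r s p \<le> 1"
  proof (cases "p = 2 \<and> s = 0")
    case False
    then show ?thesis using order_weight_prime_less_one[OF assms] by force
  qed (simp add: order_weight_def)
  then show ?thesis using True order_weight_one by simp
qed (use order_weight_prime_power_less[OF assms(1,2), of k] in simp)

lemma divisor_weight_nonneg:
  assumes "s < r" "s \<le> 0"
  shows "divisor_weight (order_weight r s) n m \<ge> 0"
  unfolding divisor_weight_def
proof (rule prod_nonneg)
  fix p assume "p \<in> prime_factors n"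
  then have "Factorial_Ring.prime p" by auto
  then show "0 \<le> order_weight r s (p ^ multiplicity p m) -
      (if p ^ Suc (multiplicity p m) dvd n then order_weight r s (p ^ Suc (multiplicity p m)) else 0)"
    using order_weight_prime_power_le[OF _ assms, of p "multiplicity p m"]
      order_weight_pos[of "p ^ multiplicity p m" r s] by (auto simp: prime_gt_0_nat simp del: power_Suc)
qed

text \<open>A factor can vanish only when the weights of 1 and 2 coincide, that is for
  \<open>p = 2\<close>, \<open>s = 0\<close>, \<open>n\<close> even and \<open>m\<close>
  odd.\<close>

lemma divisor_weight_pos:
  assumes "s < r" "s \<le> 0" "m > 0" and m: "s \<noteq> 0 \<or> odd n \<or> even m"
  shows "divisor_weight (order_weight r s) n m > 0"
  unfolding divisor_weight_def
proof (rule prod_pos)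
  fix p assume pn: "p \<in> prime_factors n"
  then have p: "Factorial_Ring.prime p" "p dvd n" by auto
  have "order_weight r s (p ^ Suc (multiplicity p m)) < order_weight r s (p ^ multiplicity p m)"
  proof (cases "multiplicity p m = 0")
    case True
    then have "\<not> p dvd m"
      using \<open>m > 0\<close> p(1) multiplicity_eq_zero_iff[of m p] not_prime_unit by auto
    then have "p \<noteq> 2 \<or> s \<noteq> 0" using m p by auto
    then show ?thesis using True order_weight_prime_less_one[OF p(1) assms(1,2)] order_weight_one by simp
  qed (use order_weight_prime_power_less[OF p(1) assms(1)] in simp)
  then show "0 < order_weight r s (p ^ multiplicity p m) -
      (if p ^ Suc (multiplicity p m) dvd n then order_weight r s (p ^ Suc (multiplicity p m)) else 0)"
    using order_weight_pos[of "p ^ multiplicity p m" r s] p(1) by (auto simp: prime_gt_0_nat simp del: power_Suc)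
qed

section \<open>Comparison with the cyclic group\<close>

text \<open>In additive notation the equation reads \<open>m * x = 0\<close> modulo
  \<open>N\<close>; its solutions are the multiples of \<open>N / m\<close>.\<close>

lemma card_roots_integer_mod_group:
  assumes "N > 0" "m dvd N"
  shows "card (roots (integer_mod_group N) m) = m"
proof -
  obtain k where k: "N = m * k" using assms by blast
  then have mk: "m > 0" "k > 0" using assms by auto
  have "roots (integer_mod_group N) m = {x \<in> {0..<int N}. int N dvd int m * x}"
    using assms by (auto simp: roots_def carrier_integer_mod_group)
  also have "\<dots> = (\<lambda>i. int k * i) ` {0..<int m}"
  proof (intro subset_antisym subsetI)
    fix x assume "x \<in> {x \<in> {0..<int N}. int N dvd int m * x}"
    then have x: "0 \<le> x" "x < int N" "int N dvd int m * x" by auto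
    then obtain i where i: "x = int k * i" using k mk by auto
    have "0 \<le> i" using x(1) i mk by (simp add: zero_le_mult_iff)
    moreover have "i < int m" using x(2) i mk k by (simp add: mult.commute)
    ultimately show "x \<in> (\<lambda>i. int k * i) ` {0..<int m}" using i by auto
  next
    fix x assume "x \<in> (\<lambda>i. int k * i) ` {0..<int m}"
    then show "x \<in> {x \<in> {0..<int N}. int N dvd int m * x}"
      using k mk by (auto simp: mult.commute)
  qed
  finally show ?thesis
    using mk by (simp add: card_image inj_on_def)
qed

context group
begin

text \<open>The weight of each \<open>x\<close> is expanded by \<open>sum_divisor_weight\<close> and
  the summations are swapped; a divisor \<open>m\<close> then collects the elements whose order
  divides \<open>m\<close>.\<close>

lemma R_sum_eq:
  assumes fin: "finite (carrier G)" and n: "n > 0"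
  shows "R_sum G n r s = (\<Sum>m | m dvd n. divisor_weight (order_weight r s) n m * real (card (roots G m)))"
proof -
  let ?a = "divisor_weight (order_weight r s) n"
  have "R_sum G n r s = (\<Sum>x\<in>roots G n. order_weight r s (local.ord x))"
    by (simp add: R_sum_def roots_eq_ord order_weight_def)
  also have "\<dots> = (\<Sum>x\<in>roots G n. \<Sum>m\<in>{m \<in> {m. m dvd n}. local.ord x dvd m}. ?a m)"
  proof (rule sum.cong[OF refl])
    fix x assume "x \<in> roots G n"
    then have "local.ord x dvd n" by (simp add: roots_eq_ord)
    from sum_divisor_weight[of "order_weight r s", OF order_weight_one order_weight_mult n this]
    show "order_weight r s (local.ord x) = (\<Sum>m\<in>{m \<in> {m. m dvd n}. local.ord x dvd m}. ?a m)"
      by (simp add: conj_commute)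
  qed
  also have "\<dots> = (\<Sum>m | m dvd n. \<Sum>x\<in>{x \<in> roots G n. local.ord x dvd m}. ?a m)"
    using fin n by (intro sum.swap_restrict) (simp_all add: finite_roots)
  also have "\<dots> = (\<Sum>m | m dvd n. ?a m * real (card (roots G m)))"
  proof (rule sum.cong[OF refl])
    fix m assume "m \<in> {m. m dvd n}"
    then have "{x \<in> roots G n. local.ord x dvd m} = roots G m"
      by (auto simp: roots_eq_ord intro: dvd_trans)
    then show "(\<Sum>x\<in>{x \<in> roots G n. local.ord x dvd m}. ?a m) = ?a m * real (card (roots G m))"
      by simp
  qed
  finally show ?thesis .
qed

text \<open>A unique involution is fixed by every conjugation, hence central. Both terms in
  \<open>card_roots_coprime_mult\<close> then count roots in all of \<open>G\<close>.\<close>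

lemma card_roots_double:
  assumes fin: "finite (carrier G)" and "odd m" and two: "card (roots G 2) = 2"
  shows "card (roots G (2 * m)) = 2 * card (roots G m)"
proof -
  have central: "centralizer G z = carrier G" if z: "z \<in> roots G 2" for z
  proof -
    have zG: "z \<in> carrier G" using z by (simp add: roots_def)
    have "g \<otimes> z = z \<otimes> g" if g: "g \<in> carrier G" for g
    proof (cases "z = \<one>")
      case False
      let ?w = "g \<otimes> z \<otimes> inv g"
      have w: "?w \<in> roots G 2" "?w \<noteq> \<one>"
        using g z zG False by (simp_all add: conj_in_roots_iff conj_eq_one_iff)
      have "card (roots G 2 - {\<one>}) = 1"
        using two one_in_roots finite_roots[OF fin] by simp
      then have "?w = z"
        using w z False by (metis DiffI card_1_singletonE singletonD)
      then show ?thesis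
        using g zG inv_solve_right[of z "g \<otimes> z" g] by auto
    qed (use g in simp)
    then show ?thesis by (auto simp: centralizer_def)
  qed
  have "coprime m 2" using \<open>odd m\<close> by simp
  then have "card (roots G (m * 2)) = (\<Sum>z\<in>roots G 2. card (roots (G\<lparr>carrier := centralizer G z\<rparr>) m))"
    by (rule card_roots_coprime_mult[OF fin])
  also have "\<dots> = (\<Sum>z\<in>roots G 2. card (roots G m))"
    using central by simp
  finally show ?thesis using two by (simp add: mult.commute)
qed

text \<open>Uniqueness for order \<open>m\<close> means exactly \<open>totient m\<close> elements of
  that order, so both directions compare \<open>card_roots_sum\<close> with the divisor sum of the
  totient.\<close>

lemma card_roots_eq_iff_unique_cyclic_subgroups:
  assumes fin: "finite (carrier G)" and n: "n > 0"
  shows "(\<forall>m. m dvd n \<longrightarrow> card (roots G m) = m) \<longleftrightarrow> (\<forall>m. m dvd n \<longrightarrow> card (cyclic_subgroups m) = 1)"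
proof
  assume L: "\<forall>m. m dvd n \<longrightarrow> card (roots G m) = m"
  have "m dvd n \<longrightarrow> card (elements_of_order m) = totient m" for m
  proof (induction m rule: less_induct)
    case (less m)
    show ?case
    proof
      assume m: "m dvd n"
      have m0: "m > 0" using m n by (auto intro: Nat.gr0I)
      \<comment> \<open>Isolating \<open>d = m\<close> lets the induction hypothesis cancel all
        proper divisors from the two sums.\<close>
      have split: "{d. d dvd m} = insert m {d. d dvd m \<and> d \<noteq> m}" by auto
      have fin_div: "finite {d. d dvd m \<and> d \<noteq> m}" using m0 by simp
      have "card (elements_of_order d) = totient d" if "d dvd m" "d \<noteq> m" for d
        using less[of d] that m m0 by (meson dvd_imp_le dvd_trans order_le_neq_trans)
      then have "(\<Sum>d | d dvd m \<and> d \<noteq> m. card (elements_of_order d)) = (\<Sum>d | d dvd m \<and> d \<noteq> m. totient d)"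
        by (intro sum.cong) auto
      moreover have "(\<Sum>d | d dvd m. card (elements_of_order d)) = (\<Sum>d | d dvd m. totient d)"
        using L m card_roots_sum[OF fin m0] totient_divisor_sum[of m] by simp
      ultimately show "card (elements_of_order m) = totient m"
        unfolding split using fin_div by simp
    qed
  qed
  then show "\<forall>m. m dvd n \<longrightarrow> card (cyclic_subgroups m) = 1"
    using n card_elements_of_order[OF fin] by (fastforce intro: Nat.gr0I)
next
  assume R: "\<forall>m. m dvd n \<longrightarrow> card (cyclic_subgroups m) = 1"
  show "\<forall>m. m dvd n \<longrightarrow> card (roots G m) = m"
  proof (intro allI impI)
    fix m assume m: "m dvd n"
    then have m0: "m > 0" using n by (auto intro: Nat.gr0I)
    have "card (roots G m) = (\<Sum>d | d dvd m. card (elements_of_order d))"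
      by (rule card_roots_sum[OF fin m0])
    also have "\<dots> = (\<Sum>d | d dvd m. totient d)"
      using R m card_elements_of_order[OF fin] by (intro sum.cong) (auto intro: dvd_trans)
    finally show "card (roots G m) = m" by (simp add: totient_divisor_sum)
  qed
qed

end

lemma card_Collect_eq_1_iff: "card {x. P x} = 1 \<longleftrightarrow> (\<exists>!x. P x)"
proof
  assume "card {x. P x} = 1"
  then obtain x where "{x. P x} = {x}" by (rule card_1_singletonE)
  then show "\<exists>!x. P x" by (intro ex1I[of _ x]) auto
next
  assume "\<exists>!x. P x"
  then obtain x where "{x. P x} = {x}" by auto
  then show "card {x. P x} = 1" by simp
qed

theorem mainTheorem4:
  fixes G :: "('a, 'b) monoid_scheme" and n :: nat and r s :: real
  assumes "group G" and "finite (carrier G)"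
    and "n > 0" and "n dvd order G"
    and "s < r" and "s \<le> 0"
  shows "T_diff G n r s \<ge> 0 \<and>
         (T_diff G n r s = 0 \<longleftrightarrow>
            (\<forall>m. m > 0 \<and> m dvd n \<longrightarrow>
               (\<exists>!H. subgroup H G \<and> cyclic_group (G\<lparr>carrier := H\<rparr>) \<and> card H = m)))"
proof -
  interpret group G by fact
  note fin = assms(2) and n = assms(3)
  let ?N = "order G"
  let ?a = "divisor_weight (order_weight r s) n"
  let ?t = "\<lambda>m. ?a m * (real (card (roots G m)) - real m)"
  interpret C: group "integer_mod_group ?N" by simp
  have N0: "?N > 0" using fin order_gt_0_iff_finite by simp
  have "finite (carrier (integer_mod_group ?N))"
    using N0 by (simp add: carrier_integer_mod_group)
  then have "R_sum (integer_mod_group ?N) n r s =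
      (\<Sum>m | m dvd n. ?a m * real (card (roots (integer_mod_group ?N) m)))"
    by (rule C.R_sum_eq[OF _ n])
  also have "\<dots> = (\<Sum>m | m dvd n. ?a m * real m)"
    using N0 assms(4) dvd_trans by (intro sum.cong) (auto simp: card_roots_integer_mod_group)
  finally have T: "T_diff G n r s = (\<Sum>m | m dvd n. ?t m)"
    by (simp add: T_diff_def R_sum_eq[OF fin n] sum_subtractf right_diff_distrib)
  \<comment> \<open>The count is positive because of the identity, so Frobenius' divisibility gives
    an inequality.\<close>
  have ge: "m \<le> card (roots G m)" if "m dvd n" for m
    using frobenius_dvd_card_roots[OF fin] card_roots_pos[OF fin] that assms(4)
    by (meson dvd_imp_le dvd_trans)
  have nonneg: "0 \<le> ?t m" if "m \<in> {m. m dvd n}" for m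
    using ge that divisor_weight_nonneg[OF assms(5,6)] by simp
  have fin_div: "finite {m. m dvd n}" using n by simp
  have "(\<Sum>m | m dvd n. ?t m) = 0 \<longleftrightarrow> (\<forall>m. m dvd n \<longrightarrow> card (roots G m) = m)"
  proof
    assume "(\<Sum>m | m dvd n. ?t m) = 0"
    then have zero: "?t m = 0" if "m dvd n" for m
      using sum_nonneg_eq_0_iff[OF fin_div nonneg] that by simp
    have eq: "card (roots G m) = m" if "m dvd n" "s \<noteq> 0 \<or> odd n \<or> even m" for m
    proof -
      have "m > 0" using that(1) n by (auto intro: Nat.gr0I)
      then show ?thesis
        using zero[OF that(1)] divisor_weight_pos[OF assms(5,6) _ that(2)] by auto
    qed
    \<comment> \<open>The weight at odd \<open>m\<close> may be zero here, but \<open>2 * m\<close>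
      and 2 are even divisors of \<open>n\<close> with positive weight, and their counts determine
      the one for \<open>m\<close>.\<close>
    have "card (roots G m) = m" if m: "m dvd n" "even n" "odd m" for m
    proof -
      have "2 * m dvd n" using m by (intro divides_mult) auto
      then have "card (roots G (2 * m)) = 2 * m" by (intro eq) auto
      moreover have "card (roots G 2) = 2" using m by (intro eq) auto
      ultimately show ?thesis using card_roots_double[OF fin m(3)] by simp
    qed
    then show "\<forall>m. m dvd n \<longrightarrow> card (roots G m) = m" using eq by blast
  qed simp
  also have "\<dots> \<longleftrightarrow> (\<forall>m. m dvd n \<longrightarrow> card (cyclic_subgroups m) = 1)"
    by (rule card_roots_eq_iff_unique_cyclic_subgroups[OF fin n])
  also have "\<dots> \<longleftrightarrow> (\<forall>m. m > 0 \<and> m dvd n \<longrightarrow>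
      (\<exists>!H. subgroup H G \<and> cyclic_group (G\<lparr>carrier := H\<rparr>) \<and> card H = m))"
  proof -
    have "m > 0" if "m dvd n" for m using that n by (auto intro: Nat.gr0I)
    then have "(\<forall>m. m dvd n \<longrightarrow> Q m) \<longleftrightarrow> (\<forall>m. m > 0 \<and> m dvd n \<longrightarrow> Q m)" for Q
      by blast
    then show ?thesis by (simp only: card_Collect_eq_1_iff)
  qed
  finally show ?thesis
    unfolding T using sum_nonneg[of "{m. m dvd n}" ?t] nonneg by blast
qed

end
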